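(* Let $(\mathcal P,g)$ be a Riemannian manifold, let $\nabla$ be an affine connection on $\mathcal P$, let $\nabla^*$ be its $g$-dual connection and $\nabla^g$ the Levi--Civita connection of $g$. Let $A=M_\nabla$, $M=M_{\nabla^*}$, $M_g=M_{\nabla^g}$ denote the corresponding midpoint means. Let $\mathcal D\subset\mathcal P\times\mathcal P$ be a domain on which $A$, $M$ and $M_g$ are all defined, that is, each pair $(P,Q)\in\mathcal D$ is joined by a unique geodesic of each of the three connections. Set $T(P,Q):=(A(P,Q),M(P,Q))$ and assume $T(\mathcal D)\subseteq\mathcal D$. For $n=0,1,\dots$ let $T^n$ be the $n$-fold iterate of $T$, with $T^0=\mathrm{id}_{\mathcal D}$. Suppose that for every $(P,Q)\in\mathcal D$ there exists a point $L(P,Q)\in\mathcal P$ such that $$T^n(P,Q)\longrightarrow (L(P,Q),L(P,Q)),\qquad n\to\infty,$$ so that the Gauss composition $(A\otimes M)(P,Q)=L(P,Q)$ is defined for every $(P,Q)\in\mathcal D$, and suppose that $M_g$ is also defined at each limit pair $(L(P,Q),L(P,Q))$ and is continuous there. Then $A\otimes M=M_g$ on $\mathcal D$ if and only if $$M_g\bigl(A(P,Q),M(P,Q)\bigr)=M_g(P,Q)\qquad\text{for all }(P,Q)\in\mathcal D.$$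
   Context: The $g$-dual connection $\nabla^*$ of $\nabla$ is the affine connection determined by $X[g(Y,Z)]=g(\nabla_XY,Z)+g(Y,\nabla^*_XZ)$ for all vector fields $X,Y,Z$. Midpoint mean: if $D$ is an affine connection and $P,Q$ are joined by a unique affinely parametrized $D$-geodesic $\gamma:[0,1]\to\mathcal P$ with $\gamma(0)=P$, $\gamma(1)=Q$, then $M_D(P,Q):=\gamma(1/2)$ (midpoint in the affine parameter, not in $g$-arc length). By uniqueness, $M_D(P,Q)=M_D(Q,P)$ and $M_D(P,P)=P$. Gauss composition: put $(P_0,Q_0)=(P,Q)$, $(P_{n+1},Q_{n+1})=(A(P_n,Q_n),M(P_n,Q_n))$, i.e. $(P_n,Q_n)=T^n(P,Q)$; if both sequences converge to the same point, that point is $(A\otimes M)(P,Q)$. *)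

theory Defs
  imports "HOL-Analysis.Analysis"
begin

text \<open>
  Derivatives are taken within \<open>S\<close>. The definition is used for open \<open>S\<close>, and for relatively open
  subsets of \<open>[0,1]\<close>, where it gives one-sided derivatives at the end points.
\<close>

primrec C_k_on :: "nat \<Rightarrow> 'a::real_normed_vector set \<Rightarrow> ('a \<Rightarrow> 'b::real_normed_vector) \<Rightarrow> bool" where
  "C_k_on 0 S f \<longleftrightarrow> continuous_on S f"
| "C_k_on (Suc k) S f \<longleftrightarrow>
     f differentiable_on S \<and> (\<forall>v. C_k_on k S (\<lambda>x. frechet_derivative f (at x within S) v))"

definition smooth_on :: "'a::real_normed_vector set \<Rightarrow> ('a \<Rightarrow> 'b::real_normed_vector) \<Rightarrow> bool" where
  "smooth_on S f \<longleftrightarrow> (\<forall>k. C_k_on k S f)"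


section \<open>Smooth manifolds\<close>

text \<open>
  The manifold is the whole type \<open>'p\<close>, Hausdorff and second countable by its type class, together
  with a smooth atlas modelled on the Euclidean space \<open>'e\<close>. A chart is a pair of an open set \<open>U\<close>
  and a map that is relevant only on \<open>U\<close>. The atlas need not be maximal.
\<close>

type_synonym ('p, 'e) chart = "'p set \<times> ('p \<Rightarrow> 'e)"

abbreviation chart_inv :: "('p, 'e) chart \<Rightarrow> 'e \<Rightarrow> 'p" where
  "chart_inv c \<equiv> inv_into (fst c) (snd c)"

definition smooth_atlas ::
    "('p::{t2_space,second_countable_topology}, 'e::euclidean_space) chart set \<Rightarrow> bool" where
  "smooth_atlas \<A> \<longleftrightarrow>
     (\<Union>c\<in>\<A>. fst c) = UNIV \<and>
     (\<forall>c\<in>\<A>. open (fst c) \<and> open (snd c ` fst c) \<and>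
        homeomorphism (fst c) (snd c ` fst c) (snd c) (chart_inv c)) \<and>
     (\<forall>c\<in>\<A>. \<forall>d\<in>\<A>. smooth_on (snd c ` (fst c \<inter> fst d)) (snd d \<circ> chart_inv c))"

definition smooth_fun ::
    "('p, 'e::euclidean_space) chart set \<Rightarrow> ('p \<Rightarrow> real) \<Rightarrow> bool" where
  "smooth_fun \<A> f \<longleftrightarrow> (\<forall>c\<in>\<A>. smooth_on (snd c ` fst c) (f \<circ> chart_inv c))"


section \<open>Tangent vectors and vector fields\<close>

text \<open>
  Tangent vectors at \<open>p\<close> are derivations at \<open>p\<close> of the algebra of smooth functions. They are set
  to \<open>0\<close> on functions that are not smooth, so that equality of tangent vectors is equality in HOL.
\<close>

type_synonym 'p tvec = "('p \<Rightarrow> real) \<Rightarrow> real"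
type_synonym 'p vfield = "'p \<Rightarrow> 'p tvec"

definition tangent_vector ::
    "('p, 'e::euclidean_space) chart set \<Rightarrow> 'p \<Rightarrow> 'p tvec \<Rightarrow> bool" where
  "tangent_vector \<A> p v \<longleftrightarrow>
     (\<forall>f h. smooth_fun \<A> f \<longrightarrow> smooth_fun \<A> h \<longrightarrow>
        v (\<lambda>q. f q + h q) = v f + v h \<and>
        v (\<lambda>q. f q * h q) = f p * v h + h p * v f) \<and>
     (\<forall>a f. smooth_fun \<A> f \<longrightarrow> v (\<lambda>q. a * f q) = a * v f) \<and>
     (\<forall>f. \<not> smooth_fun \<A> f \<longrightarrow> v f = 0)"

definition vector_field ::
    "('p, 'e::euclidean_space) chart set \<Rightarrow> 'p vfield \<Rightarrow> bool" where
  "vector_field \<A> X \<longleftrightarrow>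
     (\<forall>p. tangent_vector \<A> p (X p)) \<and>
     (\<forall>f. smooth_fun \<A> f \<longrightarrow> smooth_fun \<A> (\<lambda>p. X p f))"

definition lie_bracket :: "'p vfield \<Rightarrow> 'p vfield \<Rightarrow> 'p vfield" where
  "lie_bracket X Y = (\<lambda>p f. X p (\<lambda>q. Y q f) - Y p (\<lambda>q. X q f))"


section \<open>Riemannian metrics and affine connections\<close>

type_synonym 'p metric = "'p \<Rightarrow> 'p tvec \<Rightarrow> 'p tvec \<Rightarrow> real"

definition riemannian_metric ::
    "('p, 'e::euclidean_space) chart set \<Rightarrow> 'p metric \<Rightarrow> bool" where
  "riemannian_metric \<A> g \<longleftrightarrow>
     (\<forall>p u v w. tangent_vector \<A> p u \<longrightarrow> tangent_vector \<A> p v \<longrightarrow> tangent_vector \<A> p w \<longrightarrow>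
        g p u v = g p v u \<and>
        (\<forall>a b. g p (\<lambda>f. a * u f + b * v f) w = a * g p u w + b * g p v w) \<and>
        (u \<noteq> (\<lambda>f. 0) \<longrightarrow> g p u u > 0)) \<and>
     (\<forall>X Y. vector_field \<A> X \<longrightarrow> vector_field \<A> Y \<longrightarrow> smooth_fun \<A> (\<lambda>p. g p (X p) (Y p)))"

text \<open>A connection \<open>D\<close> takes \<open>X\<close> and \<open>Y\<close> to the vector field \<open>D\<^sub>X Y\<close>.\<close>

type_synonym 'p conn = "'p vfield \<Rightarrow> 'p vfield \<Rightarrow> 'p vfield"

definition affine_connection ::
    "('p, 'e::euclidean_space) chart set \<Rightarrow> 'p conn \<Rightarrow> bool" where
  "affine_connection \<A> D \<longleftrightarrow>
     (\<forall>X Y. vector_field \<A> X \<longrightarrow> vector_field \<A> Y \<longrightarrow> vector_field \<A> (D X Y)) \<and>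
     (\<forall>X Y Z. vector_field \<A> X \<longrightarrow> vector_field \<A> Y \<longrightarrow> vector_field \<A> Z \<longrightarrow>
        D (\<lambda>p h. X p h + Y p h) Z = (\<lambda>p h. D X Z p h + D Y Z p h) \<and>
        D X (\<lambda>p h. Y p h + Z p h) = (\<lambda>p h. D X Y p h + D X Z p h)) \<and>
     (\<forall>f X Y. smooth_fun \<A> f \<longrightarrow> vector_field \<A> X \<longrightarrow> vector_field \<A> Y \<longrightarrow>
        D (\<lambda>p h. f p * X p h) Y = (\<lambda>p h. f p * D X Y p h) \<and>
        D X (\<lambda>p h. f p * Y p h) = (\<lambda>p h. X p f * Y p h + f p * D X Y p h))"

definition dual_connection ::
    "('p, 'e::euclidean_space) chart set \<Rightarrow> 'p metric \<Rightarrow> 'p conn \<Rightarrow> 'p conn \<Rightarrow> bool" where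
  "dual_connection \<A> g D D' \<longleftrightarrow>
     affine_connection \<A> D' \<and>
     (\<forall>X Y Z p. vector_field \<A> X \<longrightarrow> vector_field \<A> Y \<longrightarrow> vector_field \<A> Z \<longrightarrow>
        X p (\<lambda>q. g q (Y q) (Z q)) = g p (D X Y p) (Z p) + g p (Y p) (D' X Z p))"

definition levi_civita ::
    "('p, 'e::euclidean_space) chart set \<Rightarrow> 'p metric \<Rightarrow> 'p conn \<Rightarrow> bool" where
  "levi_civita \<A> g D \<longleftrightarrow>
     affine_connection \<A> D \<and>
     (\<forall>X Y Z p. vector_field \<A> X \<longrightarrow> vector_field \<A> Y \<longrightarrow> vector_field \<A> Z \<longrightarrow>
        X p (\<lambda>q. g q (Y q) (Z q)) = g p (D X Y p) (Z p) + g p (Y p) (D X Z p)) \<and>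
     (\<forall>X Y. vector_field \<A> X \<longrightarrow> vector_field \<A> Y \<longrightarrow>
        (\<lambda>p f. D X Y p f - D Y X p f) = lie_bracket X Y)"


section \<open>Geodesics\<close>

text \<open>The coordinate tangent vector \<open>\<partial>\<^sub>b\<close> of the chart \<open>c\<close> at the point \<open>q\<close> of its domain.\<close>

definition coord_vector ::
    "('p, 'e::euclidean_space) chart set \<Rightarrow> ('p, 'e) chart \<Rightarrow> 'e \<Rightarrow> 'p vfield" where
  "coord_vector \<A> c b = (\<lambda>q f.
     if smooth_fun \<A> f then frechet_derivative (f \<circ> chart_inv c) (at (snd c q)) b else 0)"

text \<open>
  Connections act on globally defined vector fields. The value at \<open>p\<close> of the covariant derivative of
  \<open>\<partial>\<^sub>b'\<close> along \<open>\<partial>\<^sub>b\<close> is therefore computed from global vector fields that agree near \<open>p\<close>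
  with the coordinate fields. These exist for \<open>p\<close> in the domain of \<open>c\<close> (use bump functions), and
  the value does not depend on the choice, since connections are local operators.
\<close>

definition coord_extension ::
    "('p::topological_space, 'e::euclidean_space) chart set \<Rightarrow> ('p, 'e) chart \<Rightarrow> 'e \<Rightarrow> 'p \<Rightarrow>
     'p vfield" where
  "coord_extension \<A> c b p =
     (SOME E. vector_field \<A> E \<and> (\<forall>\<^sub>F q in nhds p. E q = coord_vector \<A> c b q))"

definition coord_nabla ::
    "('p::topological_space, 'e::euclidean_space) chart set \<Rightarrow> 'p conn \<Rightarrow> ('p, 'e) chart \<Rightarrow>
     'e \<Rightarrow> 'e \<Rightarrow> 'p vfield" where
  "coord_nabla \<A> D c b b' = (\<lambda>p. D (coord_extension \<A> c b p) (coord_extension \<A> c b' p) p)"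

text \<open>Only the values of a curve on \<open>[0,1]\<close> matter.\<close>

definition smooth_curve ::
    "('p::topological_space, 'e::euclidean_space) chart set \<Rightarrow> (real \<Rightarrow> 'p) \<Rightarrow> bool" where
  "smooth_curve \<A> \<gamma> \<longleftrightarrow>
     continuous_on {0..1} \<gamma> \<and>
     (\<forall>c\<in>\<A>. smooth_on {t\<in>{0..1}. \<gamma> t \<in> fst c} (snd c \<circ> \<gamma>))"

definition coord_velocity ::
    "('p, 'e::euclidean_space) chart \<Rightarrow> (real \<Rightarrow> 'p) \<Rightarrow> real \<Rightarrow> 'e" where
  "coord_velocity c \<gamma> t = vector_derivative (snd c \<circ> \<gamma>) (at t within {0..1})"

definition coord_acceleration ::
    "('p, 'e::euclidean_space) chart \<Rightarrow> (real \<Rightarrow> 'p) \<Rightarrow> real \<Rightarrow> 'e" where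
  "coord_acceleration c \<gamma> t = vector_derivative (coord_velocity c \<gamma>) (at t within {0..1})"

text \<open>
  The equation below is \<open>\<Sum>\<^sub>k x\<^sub>k'' \<partial>\<^sub>k + \<Sum>\<^sub>i\<^sub>j x\<^sub>i' x\<^sub>j' D\<^bsub>\<partial>\<^sub>i\<^esub> \<partial>\<^sub>j = 0\<close>, i.e. the covariant
  derivative of \<open>\<gamma>'\<close> along \<open>\<gamma>\<close> vanishes, in every chart around \<open>\<gamma>(t)\<close> and with both
  sides applied to a function \<open>f\<close>. In particular \<open>\<gamma>\<close> is affinely parametrized, and constant
  curves are geodesics.
\<close>

definition geodesic ::
    "('p::topological_space, 'e::euclidean_space) chart set \<Rightarrow> 'p conn \<Rightarrow> (real \<Rightarrow> 'p) \<Rightarrow> bool" where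
  "geodesic \<A> D \<gamma> \<longleftrightarrow>
     smooth_curve \<A> \<gamma> \<and>
     (\<forall>c\<in>\<A>. \<forall>t\<in>{0..1}. \<gamma> t \<in> fst c \<longrightarrow>
        (\<forall>f. (\<Sum>k\<in>Basis. (coord_acceleration c \<gamma> t \<bullet> k) * coord_vector \<A> c k (\<gamma> t) f) +
             (\<Sum>i\<in>Basis. \<Sum>j\<in>Basis. (coord_velocity c \<gamma> t \<bullet> i) * (coord_velocity c \<gamma> t \<bullet> j) *
                coord_nabla \<A> D c i j (\<gamma> t) f) = 0))"

definition geodesic_joins ::
    "('p::topological_space, 'e::euclidean_space) chart set \<Rightarrow> 'p conn \<Rightarrow> 'p \<times> 'p \<Rightarrow>
     (real \<Rightarrow> 'p) \<Rightarrow> bool" where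
  "geodesic_joins \<A> D x \<gamma> \<longleftrightarrow> geodesic \<A> D \<gamma> \<and> \<gamma> 0 = fst x \<and> \<gamma> 1 = snd x"


section \<open>Midpoint means and Gauss composition\<close>

text \<open>The pairs joined by a unique geodesic; uniqueness is that of the restriction to \<open>[0,1]\<close>.\<close>

definition mean_domain ::
    "('p::topological_space, 'e::euclidean_space) chart set \<Rightarrow> 'p conn \<Rightarrow> ('p \<times> 'p) set" where
  "mean_domain \<A> D =
     {x. \<exists>\<gamma>. geodesic_joins \<A> D x \<gamma> \<and>
           (\<forall>\<eta>. geodesic_joins \<A> D x \<eta> \<longrightarrow> (\<forall>t\<in>{0..1}. \<eta> t = \<gamma> t))}"

text \<open>Meaningful on \<open>mean_domain \<A> D\<close> only.\<close>

definition midpoint_mean ::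
    "('p::topological_space, 'e::euclidean_space) chart set \<Rightarrow> 'p conn \<Rightarrow> 'p \<times> 'p \<Rightarrow> 'p" where
  "midpoint_mean \<A> D x = (THE m. \<exists>\<gamma>. geodesic_joins \<A> D x \<gamma> \<and> m = \<gamma> (1/2))"

definition gauss_map :: "('p \<times> 'p \<Rightarrow> 'p) \<Rightarrow> ('p \<times> 'p \<Rightarrow> 'p) \<Rightarrow> 'p \<times> 'p \<Rightarrow> 'p \<times> 'p" where
  "gauss_map A M x = (A x, M x)"

text \<open>Meaningful when both component sequences converge to the same point.\<close>

definition gauss_composition ::
    "('p::topological_space \<times> 'p \<Rightarrow> 'p) \<Rightarrow> ('p \<times> 'p \<Rightarrow> 'p) \<Rightarrow> 'p \<times> 'p \<Rightarrow> 'p" where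
  "gauss_composition A M x =
     (THE l. (\<lambda>n. fst ((gauss_map A M ^^ n) x)) \<longlonglongrightarrow> l \<and> (\<lambda>n. snd ((gauss_map A M ^^ n) x)) \<longlonglongrightarrow> l)"

end

theory Submission
  imports Defs
begin

text \<open>
  Write \<open>L\<close> for the Gauss composition. The \<open>T\<close>-orbits of \<open>x\<close> and of \<open>T x\<close> differ by one shift, so
  \<open>L \<circ> T = L\<close>: the composition is an invariant of the iteration. If \<open>M\<^sub>g = L\<close>, then \<open>M\<^sub>g\<close> is invariant
  too. Conversely, an invariant \<open>M\<^sub>g\<close> is constant along each orbit, whose limit is the diagonal pair
  \<open>(L x, L x)\<close>; continuity there gives \<open>M\<^sub>g x = M\<^sub>g (L x, L x)\<close>, and a mean takes the value \<open>l\<close> at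
  \<open>(l, l)\<close>. This is the usual invariance principle for iterated means.

  Geometry enters only in that last fact, \<open>midpoint_mean_diagonal\<close>: a constant curve is a geodesic of
  every connection, since both its velocity and its acceleration vanish, so where
  the mean is defined on the diagonal, the geodesic that it takes the midpoint of is constant.
\<close>

text \<open>
  Constancy is assumed on the interval only, because a derivative within the interval is an
  arbitrary value at all other points, and the induction on the order of differentiability has to
  be applied to such derivatives.
\<close>

lemma C_k_on_const_on_unit_interval:
  fixes f :: "real \<Rightarrow> 'a::real_normed_vector"
  assumes "\<And>x. x \<in> {0..1} \<Longrightarrow> f x = a"
  shows "C_k_on k {0..1} f"
  using assms
proof (induction k arbitrary: f a)
  case 0
  then show ?case
    using continuous_on_cong[of "{0..1}" "{0..1}" f "\<lambda>_. a"] by simp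
next
  case (Suc k)
  have deriv: "(f has_derivative (\<lambda>_. 0)) (at x within {0..1})" if "x \<in> {0..1}" for x
    using that Suc.prems by (intro has_derivative_transform[OF _ _ has_derivative_const]) auto
  have "frechet_derivative f (at x within {0..1}) v = 0" if "x \<in> {0..1}" for x v
    using frechet_derivative_within_cbox[of 0 1 x f "\<lambda>_. 0"] deriv[OF that] that by simp
  then have "C_k_on k {0..1} (\<lambda>x. frechet_derivative f (at x within {0..1}) v)" for v
    by (rule Suc.IH)
  moreover have "f differentiable_on {0..1}"
    unfolding differentiable_on_def differentiable_def using deriv by blast
  ultimately show ?case by simp
qed

lemma smooth_curve_const:
  fixes \<A> :: "('a::topological_space, 'b::euclidean_space) chart set"
  shows "smooth_curve \<A> (\<lambda>_. p)"
proof -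
  have empty: "C_k_on k {} f" for k and f :: "real \<Rightarrow> 'b"
    by (induction k arbitrary: f) (auto simp: differentiable_on_def)
  \<comment> \<open>A constant curve lies in a given chart at all parameters or at none.\<close>
  have "smooth_on {t\<in>{0..1}. p \<in> fst c} (snd c \<circ> (\<lambda>_::real. p))" for c :: "('a, 'b) chart"
  proof (cases "p \<in> fst c")
    case True
    then have all: "{t\<in>{0..1}. p \<in> fst c} = {0..1::real}" by auto
    show ?thesis
      unfolding smooth_on_def all by (simp add: C_k_on_const_on_unit_interval)
  next
    case False
    then show ?thesis by (simp add: smooth_on_def empty)
  qed
  then show ?thesis
    by (simp add: smooth_curve_def)
qed

lemma vector_derivative_const_on_unit_interval:
  fixes f :: "real \<Rightarrow> 'a::real_normed_vector"
  assumes "\<And>x. x \<in> {0..1} \<Longrightarrow> f x = a" and "t \<in> {0..1}"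
  shows "vector_derivative f (at t within {0..1}) = 0"
proof -
  have "(f has_vector_derivative 0) (at t within {0..1})"
    using assms by (intro has_vector_derivative_transform[OF _ _ has_vector_derivative_const]) auto
  then show ?thesis
    using assms(2) vector_derivative_within_cbox[of 0 1 t f 0] by simp
qed

lemma geodesic_const:
  fixes \<A> :: "('a::topological_space, 'b::euclidean_space) chart set"
  shows "geodesic \<A> D (\<lambda>_. p)"
proof -
  have velocity: "coord_velocity c (\<lambda>_. p) t = 0" if "t \<in> {0..1}" for c :: "('a, 'b) chart" and t
    using that unfolding coord_velocity_def
    by (intro vector_derivative_const_on_unit_interval) auto
  then have "coord_acceleration c (\<lambda>_. p) t = 0" if "t \<in> {0..1}" for c :: "('a, 'b) chart" and t
    using that unfolding coord_acceleration_def
    by (intro vector_derivative_const_on_unit_interval)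
  with velocity show ?thesis
    by (simp add: geodesic_def smooth_curve_const)
qed

lemma midpoint_mean_eqI:
  assumes "x \<in> mean_domain \<A> D" and "geodesic_joins \<A> D x \<gamma>"
  shows "midpoint_mean \<A> D x = \<gamma> (1/2)"
proof -
  have unique: "\<eta> (1/2) = \<gamma> (1/2)" if "geodesic_joins \<A> D x \<eta>" for \<eta>
  proof -
    obtain \<gamma>' where
      "\<And>\<xi>. geodesic_joins \<A> D x \<xi> \<Longrightarrow> \<forall>t\<in>{0..1}. \<xi> t = \<gamma>' t"
      using assms(1) unfolding mean_domain_def mem_Collect_eq by metis
    from this[OF that] this[OF assms(2)] show ?thesis
      by simp
  qed
  show ?thesis
    unfolding midpoint_mean_def
  proof (rule the_equality)
    show "\<exists>\<eta>. geodesic_joins \<A> D x \<eta> \<and> \<gamma> (1/2) = \<eta> (1/2)"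
      using assms(2) by blast
    show "m = \<gamma> (1/2)" if "\<exists>\<eta>. geodesic_joins \<A> D x \<eta> \<and> m = \<eta> (1/2)" for m
    proof -
      from that obtain \<eta> where "geodesic_joins \<A> D x \<eta>" and "m = \<eta> (1/2)" by (elim exE conjE)
      with unique[of \<eta>] show ?thesis by simp
    qed
  qed
qed

text \<open>The constant curve is a geodesic from \<open>l\<close> to \<open>l\<close>; on the mean domain there is no other.\<close>

lemma midpoint_mean_diagonal:
  assumes "(l, l) \<in> mean_domain \<A> D"
  shows "midpoint_mean \<A> D (l, l) = l"
  using midpoint_mean_eqI[OF assms, of "\<lambda>_. l"]
  by (simp add: geodesic_joins_def geodesic_const)

lemma gauss_composition_eqI:
  fixes l :: "'a::t2_space"
  assumes "(\<lambda>n. (gauss_map A M ^^ n) x) \<longlonglongrightarrow> (l, l)"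
  shows "gauss_composition A M x = l"
  unfolding gauss_composition_def
proof (rule the_equality)
  show "(\<lambda>n. fst ((gauss_map A M ^^ n) x)) \<longlonglongrightarrow> l \<and> (\<lambda>n. snd ((gauss_map A M ^^ n) x)) \<longlonglongrightarrow> l"
    using tendsto_fst[OF assms] tendsto_snd[OF assms] by simp
  then show "l' = l" if "(\<lambda>n. fst ((gauss_map A M ^^ n) x)) \<longlonglongrightarrow> l' \<and>
      (\<lambda>n. snd ((gauss_map A M ^^ n) x)) \<longlonglongrightarrow> l'" for l'
    using that LIMSEQ_unique by blast
qed

text \<open>Both orbits have the same tail, so they cannot have different limits.\<close>

lemma gauss_composition_invariant:
  fixes l :: "'a::t2_space"
  assumes "(\<lambda>n. (gauss_map A M ^^ n) x) \<longlonglongrightarrow> (l, l)"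
  shows "gauss_composition A M (gauss_map A M x) = gauss_composition A M x"
proof -
  have "(\<lambda>n. (gauss_map A M ^^ n) (gauss_map A M x)) \<longlonglongrightarrow> (l, l)"
    using LIMSEQ_Suc[OF assms] by (simp add: funpow_swap1)
  with assms show ?thesis
    by (simp add: gauss_composition_eqI)
qed

text \<open>
  A function that is invariant under \<open>T\<close> is constant along the orbit, hence has at the starting
  point the value that continuity forces at the limit.
\<close>

lemma invariant_eq_value_at_orbit_limit:
  fixes N :: "'a::t2_space \<Rightarrow> 'b::t2_space"
  assumes invariant: "\<And>x. x \<in> D \<Longrightarrow> N (T x) = N x"
    and maps: "T ` D \<subseteq> D" and "D \<subseteq> S" and "x \<in> D"
    and limit: "(\<lambda>n. (T ^^ n) x) \<longlonglongrightarrow> y"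
    and cont: "continuous (at y within S) N"
  shows "N x = N y"
proof -
  have orbit: "(T ^^ n) x \<in> D \<and> N ((T ^^ n) x) = N x" for n
    using \<open>x \<in> D\<close> maps invariant by (induction n) auto
  then have "(\<lambda>n. N ((T ^^ n) x)) \<longlonglongrightarrow> N y"
    using \<open>D \<subseteq> S\<close> by (intro continuous_within_tendsto_compose'[OF cont _ limit]) auto
  then show ?thesis
    using orbit by (simp add: LIMSEQ_const_iff)
qed

theorem theorem3p1:
  fixes \<A> :: "('p::{t2_space,second_countable_topology}, 'e::euclidean_space) chart set"
    and g :: "'p metric"
    and nabla nabla_dual nabla_g :: "'p conn"
    and A M M_g L :: "'p \<times> 'p \<Rightarrow> 'p"
    and T :: "'p \<times> 'p \<Rightarrow> 'p \<times> 'p"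
    and \<D> :: "('p \<times> 'p) set"
  assumes "smooth_atlas \<A>"
    and "riemannian_metric \<A> g"
    and "affine_connection \<A> nabla"
    and "dual_connection \<A> g nabla nabla_dual"
    and "levi_civita \<A> g nabla_g"
    and A_def: "A = midpoint_mean \<A> nabla"
    and M_def: "M = midpoint_mean \<A> nabla_dual"
    and M_g_def: "M_g = midpoint_mean \<A> nabla_g"
    and T_def: "T = gauss_map A M"
    and "\<D> \<subseteq> mean_domain \<A> nabla"
    and "\<D> \<subseteq> mean_domain \<A> nabla_dual"
    and "\<D> \<subseteq> mean_domain \<A> nabla_g"
    and "T ` \<D> \<subseteq> \<D>"
    and "\<And>x. x \<in> \<D> \<Longrightarrow> (\<lambda>n. (T ^^ n) x) \<longlonglongrightarrow> (L x, L x)"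
    and "\<And>x. x \<in> \<D> \<Longrightarrow> (L x, L x) \<in> mean_domain \<A> nabla_g"
    and "\<And>x. x \<in> \<D> \<Longrightarrow> continuous (at (L x, L x) within mean_domain \<A> nabla_g) M_g"
  shows "(\<forall>x\<in>\<D>. gauss_composition A M x = M_g x) \<longleftrightarrow>
         (\<forall>P Q. (P, Q) \<in> \<D> \<longrightarrow> M_g (A (P, Q), M (P, Q)) = M_g (P, Q))"
proof -
  have maps: "T x \<in> \<D>" if "x \<in> \<D>" for x
    using that assms(13) by blast
  have limit: "(\<lambda>n. (gauss_map A M ^^ n) x) \<longlonglongrightarrow> (L x, L x)" if "x \<in> \<D>" for x
    using assms(14)[OF that] by (simp add: T_def)
  have composition: "gauss_composition A M x = L x" if "x \<in> \<D>" for x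
    using gauss_composition_eqI[OF limit[OF that]] .
  have "(\<forall>x\<in>\<D>. gauss_composition A M x = M_g x) \<longleftrightarrow> (\<forall>x\<in>\<D>. M_g (T x) = M_g x)"
  proof
    assume eq: "\<forall>x\<in>\<D>. gauss_composition A M x = M_g x"
    show "\<forall>x\<in>\<D>. M_g (T x) = M_g x"
    proof
      fix x assume x: "x \<in> \<D>"
      then show "M_g (T x) = M_g x"
        using eq maps[OF x] gauss_composition_invariant[OF limit[OF x]] by (simp add: T_def)
    qed
  next
    assume invariant: "\<forall>x\<in>\<D>. M_g (T x) = M_g x"
    show "\<forall>x\<in>\<D>. gauss_composition A M x = M_g x"
    proof
      fix x assume x: "x \<in> \<D>"
      have "M_g x = M_g (L x, L x)"
        using invariant_eq_value_at_orbit_limit[of \<D> M_g T, OF _ assms(13,12) x assms(14)[OF x] assms(16)[OF x]]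
          invariant by blast
      also have "\<dots> = L x"
        using midpoint_mean_diagonal[OF assms(15)[OF x]] by (simp add: M_g_def)
      finally show "gauss_composition A M x = M_g x"
        using composition[OF x] by simp
    qed
  qed
  then show ?thesis
    by (auto simp: T_def gauss_map_def)
qed

end
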